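(* Let $n\in\mathbb{N}$ and $0<t\leq 1$. Then $$ \begin{aligned} \sum_{k=1}^{\infty}\frac{(-t)^kH_{k-1}}{k^2\binom{n+k}{k}}={}&\frac{1}{2}\log t\,\log^2(t+1)-\frac{1}{3}\log^3(1+t)\\ &-\log(1+t)Li_2\left(\frac{1}{1+t}\right)-Li_3\left(\frac{1}{1+t}\right)+\zeta(3)\\ &+\log(1+t)\sum_{k=1}^{n}\frac{H_k}{k}\left(\frac{t+1}{t}\right)^k-\frac{1}{2}\log^2(1+t)\sum_{k=1}^{n}\frac{1}{k}\left(\frac{t+1}{t}\right)^k\\ &-\sum_{p=0}^{n-1}\left\{\sum_{k=1}^{n-p}\left(\frac{H_{p+k}-H_k}{(p+k)k}+\frac{1}{k^2(p+k)}\right)\right\}\left(\frac{t+1}{t}\right)^p. \end{aligned} $$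
   Context: $\mathbb{N}=\{1,2,3,\dots\}$. $H_m=\sum_{j=1}^m \frac1j$ is the $m$-th harmonic number, with $H_0=0$. $Li_m(x)=\sum_{k\ge1}x^k/k^m$ for $|x|\le1$, $m\ge2$, is the polylogarithm, and $\zeta(s)=\sum_{k\ge1}k^{-s}$ is the Riemann zeta function. $\log^m x$ means $(\log x)^m$. Infinite series are limits of partial sums. *)

theory Defs
  imports "HOL-Analysis.Analysis"
begin

text \<open>
  The series over \<open>k \<ge> 1\<close> are indexed from \<open>0\<close> with \<open>k\<close> replaced by \<open>Suc k\<close>.
  The value of \<^const>\<open>suminf\<close> is meaningful only where the series converges:
  \<open>\<bar>x\<bar> \<le> 1\<close>, \<open>m \<ge> 2\<close> for the polylogarithm and \<open>s > 1\<close> for the zeta function.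
\<close>

definition polylog :: "nat \<Rightarrow> real \<Rightarrow> real" where
  "polylog m x = (\<Sum>k. x ^ Suc k / real (Suc k) ^ m)"

definition zeta :: "real \<Rightarrow> real" where
  "zeta s = (\<Sum>k. real (Suc k) powr (- s))"

end

theory Submission
  imports Defs "HOL-Real_Asymp.Real_Asymp"
begin

text \<open>
  Write \<open>L = ln (1 + t)\<close>, \<open>w = (t + 1) / t\<close> and let \<open>B n k\<close> be the Beta value
  \<open>\<integral>x^k (1 - x)^n dx\<close> over \<open>[0, 1]\<close>, which equals \<open>1 / ((k + 1) ((n + k + 1) choose (k + 1)))\<close>.
  With the summation index shifted to start at \<open>0\<close>, the series in question is
  \<open>C n = \<Sum>k. (-t)^(k+1) H_k B n k / (k + 1)\<close>. Its dependence on \<open>n\<close> can be computed from two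
  elementary identities: \<open>B (n+1) k + B n (k+1) = B n k\<close>, that is \<open>(1 - x) + x = 1\<close> under the
  integral, and \<open>(n + 1) B n (k+1) = (k + 1) B (n+1) k\<close>, an integration by parts.
  Together they give \<open>C (n+1) = C n - T (n+1) / (n + 1)\<close>, where \<open>T n\<close> is the same series without
  the denominator \<open>k + 1\<close> (\<open>harm_dilog_series_Suc\<close>).

  In \<open>T n\<close>, and in the series \<open>A n\<close> that arises from it by dropping \<open>H_k\<close>, the difference in \<open>n\<close>
  is by the first identity a shift in \<open>k\<close>, hence, up to the factor \<open>-t\<close>, again the series itself
  with its first term removed, except that shifting \<open>H_k\<close> leaves behind a term \<open>1 / (k + 1)\<close>. So both satisfy first-order
  linear recurrences with ratio \<open>w\<close>, and \<open>A\<close> drives the one for \<open>T\<close> (\<open>log_series_Suc\<close>,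
  \<open>harm_series_Suc\<close>). Solving them (\<open>log_series_closed\<close>, \<open>harm_series_closed\<close>) produces
  the powers of \<open>w\<close>, and summing \<open>T m / m\<close> over \<open>m \<le> n\<close> produces the three finite sums.

  The initial values are classical: \<open>A 0 = -L\<close>, \<open>T 0 = L^2 / 2\<close>, and \<open>C 0\<close> is an antiderivative of
  \<open>L^2 / (2 t)\<close>. The polylogarithmic expression has the same derivative, and as \<open>t\<close> tends to \<open>0\<close>
  it tends to \<open>zeta 3 - polylog 3 1 = 0\<close> (\<open>harm_dilog_series_0\<close>).

  At \<open>t = 1\<close> the series \<open>A 0\<close> and \<open>T 0\<close> converge only conditionally. The argument is
  therefore carried out for \<open>0 < t < 1\<close>. For \<open>n \<ge> 1\<close> the terms of \<open>C n\<close> are dominated by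
  \<open>1 / (k + 1)^2\<close> uniformly for \<open>\<bar>t\<bar> \<le> 1\<close>, and so both sides are continuous up to \<open>t = 1\<close>
  (\<open>harm_dilog_series_closed_at_1\<close>).
\<close>

section \<open>Power series and uniform limits\<close>

lemma continuous_on_suminf_dominated:
  fixes f :: "nat \<Rightarrow> real \<Rightarrow> real"
  assumes "\<And>k. continuous_on X (f k)"
    and "\<And>k x. x \<in> X \<Longrightarrow> \<bar>f k x\<bar> \<le> M k" and "summable M"
  shows "continuous_on X (\<lambda>x. \<Sum>k. f k x)"
proof (rule uniform_limit_theorem)
  show "uniform_limit X (\<lambda>n x. \<Sum>i<n. f i x) (\<lambda>x. \<Sum>k. f k x) sequentially"
    using assms(2,3) by (intro Weierstrass_m_test[where M = M]) auto
  show "\<forall>\<^sub>F n in sequentially. continuous_on X (\<lambda>x. \<Sum>i<n. f i x)"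
    using assms(1) by (intro always_eventually allI continuous_on_sum) auto
qed simp

lemma summable_inverse_Suc_power:
  "m \<ge> 2 \<Longrightarrow> summable (\<lambda>k. 1 / real (Suc k) ^ m)"
  using inverse_power_summable[of m, where ?'a = real]
  by (subst (asm) summable_Suc_iff[symmetric]) (simp_all add: inverse_eq_divide del: of_nat_Suc)

lemma summable_bounded_mult_power:
  fixes a :: "nat \<Rightarrow> real"
  assumes "\<And>k. \<bar>a k\<bar> \<le> 1" and "\<bar>x\<bar> < 1"
  shows "summable (\<lambda>k. a k * x ^ k)"
proof (rule summable_comparison_test')
  show "summable (\<lambda>k. \<bar>x\<bar> ^ k)" using assms(2) by (simp add: summable_geometric)
  fix k show "norm (a k * x ^ k) \<le> \<bar>x\<bar> ^ k"
    using mult_right_mono[OF assms(1)[of k], of "\<bar>x\<bar> ^ k"]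
    by (simp add: abs_mult power_abs)
qed

lemma summable_bounded_mult_power_Suc:
  fixes a :: "nat \<Rightarrow> real"
  assumes "\<And>k. \<bar>a k\<bar> \<le> 1" and "\<bar>x\<bar> < 1"
  shows "summable (\<lambda>k. x ^ Suc k * a k)"
proof -
  have "summable (\<lambda>k. x * (a k * x ^ k))"
    by (intro summable_mult summable_bounded_mult_power assms)
  then show ?thesis by (simp only: power_Suc mult_ac)
qed

text \<open>
  The antiderivative is written with the factor \<open>x ^ Suc k\<close> in front because all series below
  have that shape; every derivative of a series in this development is an instance.
\<close>

lemma has_field_derivative_antiderivative_series:
  fixes a :: "nat \<Rightarrow> real"
  assumes "\<And>x. \<bar>x\<bar> < 1 \<Longrightarrow> summable (\<lambda>k. a k * x ^ k)" and "\<bar>x\<bar> < 1"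
  shows "((\<lambda>x. \<Sum>k. x ^ Suc k * (a k / real (Suc k))) has_field_derivative
           (\<Sum>k. a k * x ^ k)) (at x)"
proof -
  define b where "b k = (case k of 0 \<Rightarrow> 0 | Suc j \<Rightarrow> a j / real (Suc j))" for k
  have db: "diffs b = a" by (auto simp: diffs_def b_def fun_eq_iff)
  have smb: "summable (\<lambda>k. b k * y ^ k)" if "\<bar>y\<bar> < 1" for y
  proof -
    have "summable (\<lambda>k. a k * y ^ k / real (Suc k))"
    proof (rule summable_comparison_test')
      (* The comparison needs absolute convergence at y, which follows from convergence at a
         point of larger modulus. *)
      define z where "z = (\<bar>y\<bar> + 1) / 2"
      have z: "norm y < norm z" "\<bar>z\<bar> < 1" using that by (auto simp: z_def)
      show "summable (\<lambda>k. norm (a k * y ^ k))"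
        by (rule powser_insidea[OF assms(1)[OF z(2)] z(1)])
      fix k show "norm (a k * y ^ k / real (Suc k)) \<le> norm (a k * y ^ k)"
        using divide_left_mono[of 1 "real (Suc k)" "norm (a k * y ^ k)"]
        by (simp only: norm_divide) simp
    qed
    then have "summable (\<lambda>k. b (Suc k) * y ^ k)" by (simp add: b_def)
    then show ?thesis by (subst (asm) summable_powser_split_head)
  qed
  have "((\<lambda>x. \<Sum>k. b k * x ^ k) has_field_derivative (\<Sum>k. diffs b k * x ^ k)) (at x)"
    by (rule termdiffs_strong'[where K = 1]) (use smb assms(2) in auto)
  then have *: "((\<lambda>x. \<Sum>k. b k * x ^ k) has_field_derivative (\<Sum>k. a k * x ^ k)) (at x)"
    by (simp add: db)
  have eq: "(\<Sum>k. y ^ Suc k * (a k / real (Suc k))) = (\<Sum>k. b k * y ^ k)"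
    if "y \<in> {-1<..<1}" for y
  proof -
    have "(\<Sum>k. b (Suc k) * y ^ Suc k) = (\<Sum>k. b k * y ^ k) - b 0 * y ^ 0"
      by (rule suminf_split_head) (use that smb[of y] in auto)
    then show ?thesis by (simp add: b_def mult_ac)
  qed
  show ?thesis
    by (rule has_field_derivative_transform_within_open[OF *, where S = "{-1<..<1}"])
      (use assms(2) eq in auto)
qed

text \<open>
  Fixes the constant of integration at an end point where the function itself, here one involving
  \<open>ln t\<close>, need not be continuous.
\<close>

lemma has_real_derivative_zero_imp_right_limit:
  fixes f :: "real \<Rightarrow> real"
  assumes "\<And>x. a < x \<Longrightarrow> x < b \<Longrightarrow> (f has_real_derivative 0) (at x)"
    and "(f \<longlongrightarrow> l) (at_right a)" and "a < t" "t < b"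
  shows "f t = l"
proof -
  have "\<forall>\<^sub>F x in at_right a. f x = f t"
    using eventually_at_right[OF assms(3)]
  proof (rule iffD2, intro exI conjI allI impI)
    show "a < t" by fact
    fix x assume "a < x" "x < t"
    then show "f x = f t"
      using assms by (intro DERIV_isconst3[of a b x t f]) auto
  qed
  then have "((\<lambda>_. f t) \<longlongrightarrow> l) (at_right a)"
    using assms(2) by (simp cong: tendsto_cong add: filterlim_cong)
  then show ?thesis by (simp add: tendsto_const_iff)
qed

section \<open>Polylogarithms\<close>

lemma continuous_on_polylog:
  assumes "m \<ge> 2"
  shows "continuous_on {0..1} (polylog m)"
  unfolding polylog_def
proof (rule continuous_on_suminf_dominated)
  show "summable (\<lambda>k. 1 / real (Suc k) ^ m)"
    by (rule summable_inverse_Suc_power[OF assms])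
  fix k and x :: real assume "x \<in> {0..1}"
  then show "\<bar>x ^ Suc k / real (Suc k) ^ m\<bar> \<le> 1 / real (Suc k) ^ m"
    using power_le_one[of x "Suc k"] by (auto intro!: divide_right_mono simp del: power_Suc)
qed (auto intro!: continuous_intros)

lemma polylog_3_1: "polylog 3 1 = zeta 3"
  by (simp add: polylog_def zeta_def powr_minus powr_numeral inverse_eq_divide)

lemma polylog_1:
  assumes "0 < x" "x < 1"
  shows "polylog 1 x = - ln (1 - x)"
proof -
  have "ln (1 - x) = (\<Sum>k. (- 1) ^ k * (1 / real (k + 1)) * (1 - x - 1) ^ Suc k)"
    by (rule ln_series) (use assms in auto)
  also have "\<dots> = (\<Sum>k. - (x ^ Suc k / real (Suc k) ^ 1))"
    by (intro suminf_cong) (simp add: power_minus[of x])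
  also have "\<dots> = - polylog 1 x"
    unfolding polylog_def
    using assms summable_bounded_mult_power_Suc[of "\<lambda>k. 1 / real (Suc k)" x]
    by (intro suminf_minus) simp
  finally show ?thesis by simp
qed

lemma has_field_derivative_polylog_Suc:
  assumes "0 < x" "x < 1"
  shows "(polylog (Suc m) has_field_derivative polylog m x / x) (at x)"
proof -
  define a where "a k = 1 / real (Suc k) ^ m" for k
  have sm: "summable (\<lambda>k. a k * y ^ k)" if "\<bar>y\<bar> < 1" for y
    by (rule summable_bounded_mult_power[OF _ that]) (simp add: a_def)
  have "polylog m x = x * (\<Sum>k. a k * x ^ k)"
    using assms suminf_mult[OF sm[of x], of x] by (simp add: polylog_def a_def)
  then have "(\<Sum>k. a k * x ^ k) = polylog m x / x" using assms by simp
  moreover have "(\<lambda>x. \<Sum>k. x ^ Suc k * (a k / real (Suc k))) = polylog (Suc m)"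
    by (simp add: polylog_def a_def fun_eq_iff mult_ac)
  ultimately show ?thesis
    using has_field_derivative_antiderivative_series[OF sm, of x] assms by simp
qed

lemma has_field_derivative_dilog:
  assumes "0 < x" "x < 1"
  shows "(polylog 2 has_field_derivative - ln (1 - x) / x) (at x)"
  using has_field_derivative_polylog_Suc[of x 1] assms
  by (simp add: polylog_1[unfolded One_nat_def] numeral_2_eq_2)

section \<open>Reciprocal binomial coefficients as Beta values\<close>

text \<open>
  The Beta function at \<open>(k + 1, n + 1)\<close>. Both indices are shifted by one so that the recurrences
  hold for all natural numbers.
\<close>

definition beta_coeff :: "nat \<Rightarrow> nat \<Rightarrow> real" where
  "beta_coeff n k = fact k * fact n / fact (n + k + 1)"

text \<open>
  Integrate \<open>x ^ k * (1 - x) ^ n * ((1 - x) + x)\<close> over \<open>[0, 1]\<close>; equivalently, the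
  rule by which Leibniz's harmonic triangle is built.
\<close>

lemma beta_coeff_pascal:
  "beta_coeff (Suc n) k + beta_coeff n (Suc k) = beta_coeff n k"
proof -
  have "real (n + k + 2) \<noteq> 0" by linarith
  then show ?thesis
    by (simp add: beta_coeff_def divide_simps) (simp add: algebra_simps)
qed

text \<open>
  Integration by parts, moving one power from \<open>x\<close> to \<open>1 - x\<close>. It trades a factor depending on \<open>k\<close>
  for one depending on \<open>n\<close>, which can be taken out of a sum over \<open>k\<close>.
\<close>

lemma beta_coeff_shift:
  "beta_coeff n (Suc k) = real (Suc k) / real (Suc n) * beta_coeff (Suc n) k"
  by (simp add: beta_coeff_def)

lemma beta_coeff_eq_binomial:
  "beta_coeff n k = 1 / (real (Suc k) * real ((n + Suc k) choose Suc k))"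
proof -
  have "real ((n + Suc k) choose Suc k) = fact (n + Suc k) / (fact (Suc k) * fact n)"
    by (subst binomial_fact) simp_all
  then show ?thesis by (simp add: beta_coeff_def del: of_nat_Suc binomial_Suc_Suc)
qed

lemma beta_coeff_0: "beta_coeff 0 k = 1 / real (Suc k)"
  by (simp add: beta_coeff_def)

lemma beta_coeff_nonneg: "0 \<le> beta_coeff n k"
  by (simp add: beta_coeff_def)

lemma beta_coeff_decseq: "beta_coeff n k \<le> beta_coeff m k" if "m \<le> n"
  using that
proof (induction rule: dec_induct)
  case (step n)
  then show ?case
    using beta_coeff_pascal[of n k] beta_coeff_nonneg[of n "Suc k"] by linarith
qed simp

lemma beta_coeff_le: "beta_coeff n k \<le> 1 / real (Suc k)"
  using beta_coeff_decseq[of 0 n k] by (simp add: beta_coeff_0)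

lemma harm_le: "harm k \<le> real k"
proof (induction k)
  case (Suc k)
  have "inverse (real (Suc k)) \<le> 1" by (simp add: inverse_le_1_iff)
  with Suc show ?case by (simp add: harm_Suc)
qed (simp add: harm_def)

lemma harm_beta_coeff_bound: "\<bar>harm k * beta_coeff n k\<bar> \<le> 1"
proof -
  have "harm k * beta_coeff n k \<le> real k * (1 / real (Suc k))"
    by (intro mult_mono harm_le beta_coeff_le beta_coeff_nonneg) auto
  also have "\<dots> \<le> 1" by simp
  finally show ?thesis by (simp add: harm_nonneg beta_coeff_nonneg)
qed

section \<open>Three series and their recurrences in n\<close>

text \<open>
  The sequences \<open>A\<close>, \<open>T\<close> and \<open>C\<close> of the introduction. At \<open>n = 0\<close> they are \<open>- ln (1 + t)\<close>,
  \<open>(ln (1 + t))\<^sup>2 / 2\<close> and the Nielsen polylogarithm \<open>S_{1,2} (- t)\<close>.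
\<close>

definition log_series :: "nat \<Rightarrow> real \<Rightarrow> real" where
  "log_series n t = (\<Sum>k. (- t) ^ Suc k * beta_coeff n k)"

definition harm_series :: "nat \<Rightarrow> real \<Rightarrow> real" where
  "harm_series n t = (\<Sum>k. (- t) ^ Suc k * (harm k * beta_coeff n k))"

definition harm_dilog_series :: "nat \<Rightarrow> real \<Rightarrow> real" where
  "harm_dilog_series n t = (\<Sum>k. (- t) ^ Suc k * (harm k * beta_coeff n k / real (Suc k)))"

lemma log_series_sums:
  "\<bar>t\<bar> < 1 \<Longrightarrow> (\<lambda>k. (- t) ^ Suc k * beta_coeff n k) sums log_series n t"
  unfolding log_series_def
  using beta_coeff_nonneg order.trans[OF beta_coeff_le[of n]]
  by (intro summable_sums summable_bounded_mult_power_Suc) auto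

lemma harm_series_sums:
  "\<bar>t\<bar> < 1 \<Longrightarrow> (\<lambda>k. (- t) ^ Suc k * (harm k * beta_coeff n k)) sums harm_series n t"
  unfolding harm_series_def using harm_beta_coeff_bound[of _ n]
  by (intro summable_sums summable_bounded_mult_power_Suc) auto

lemma harm_dilog_series_sums:
  assumes "\<bar>t\<bar> < 1"
  shows "(\<lambda>k. (- t) ^ Suc k * (harm k * beta_coeff n k / real (Suc k))) sums
           harm_dilog_series n t"
  unfolding harm_dilog_series_def
proof (intro summable_sums summable_bounded_mult_power_Suc)
  fix k show "\<bar>harm k * beta_coeff n k / real (Suc k)\<bar> \<le> 1"
    using harm_beta_coeff_bound[of k n] by (simp add: abs_divide divide_simps)
qed (use assms in simp)

text \<open>
  Multiply \<open>beta_coeff n (Suc k) = beta_coeff n k - beta_coeff (Suc n) k\<close> by \<open>(- t) ^ (k + 2)\<close> and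
  sum over \<open>k\<close>: the left side is \<open>log_series n t\<close> without its first term, which is
  \<open>- t / (n + 1)\<close>.
\<close>

lemma log_series_Suc:
  assumes "\<bar>t\<bar> < 1"
  shows "t * log_series (Suc n) t = (t + 1) * log_series n t + t / real (Suc n)"
proof -
  have "(\<lambda>k. - t * ((- t) ^ Suc k * beta_coeff n k - (- t) ^ Suc k * beta_coeff (Suc n) k)) sums
          (- t * (log_series n t - log_series (Suc n) t))"
    by (intro sums_mult sums_diff log_series_sums assms)
  also have "(\<lambda>k. - t * ((- t) ^ Suc k * beta_coeff n k - (- t) ^ Suc k * beta_coeff (Suc n) k))
      = (\<lambda>k. (- t) ^ Suc (Suc k) * beta_coeff n (Suc k))"
  proof
    fix k
    have "beta_coeff n (Suc k) = beta_coeff n k - beta_coeff (Suc n) k"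
      using beta_coeff_pascal[of n k] by simp
    then show "- t * ((- t) ^ Suc k * beta_coeff n k - (- t) ^ Suc k * beta_coeff (Suc n) k)
        = (- t) ^ Suc (Suc k) * beta_coeff n (Suc k)"
      by (simp only:) (simp add: algebra_simps)
  qed
  finally have "(\<lambda>k. (- t) ^ Suc (Suc k) * beta_coeff n (Suc k)) sums
      (- t * (log_series n t - log_series (Suc n) t))" .
  moreover have "(\<lambda>k. (- t) ^ Suc (Suc k) * beta_coeff n (Suc k)) sums
      (log_series n t - (- t) ^ Suc 0 * beta_coeff n 0)"
    using log_series_sums[OF assms, of n] by (subst sums_Suc_iff) simp
  ultimately have "- t * (log_series n t - log_series (Suc n) t) =
      log_series n t - (- t) ^ Suc 0 * beta_coeff n 0"
    by (rule sums_unique2)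
  moreover have "beta_coeff n 0 = 1 / real (Suc n)" by (simp add: beta_coeff_def)
  ultimately show ?thesis by (simp add: algebra_simps)
qed

text \<open>
  The same shift as for \<^const>\<open>log_series\<close>. Its first term vanishes since \<open>harm 0 = 0\<close>, but
  \<open>harm (Suc k)\<close> differs from \<open>harm k\<close> by \<open>1 / (k + 1)\<close>, and \<open>beta_coeff_shift\<close> turns
  \<open>beta_coeff n (Suc k) / (k + 1)\<close> into \<open>beta_coeff (Suc n) k / (n + 1)\<close>, that is, into the terms
  of \<^const>\<open>log_series\<close>.
\<close>

lemma harm_series_Suc:
  assumes "\<bar>t\<bar> < 1"
  shows "t * harm_series (Suc n) t =
           (t + 1) * harm_series n t + t / real (Suc n) * log_series (Suc n) t"
proof -
  let ?f = "\<lambda>k. (- t) ^ Suc k * (harm k * beta_coeff n k)"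
  have "(\<lambda>k. - t * (?f k - (- t) ^ Suc k * (harm k * beta_coeff (Suc n) k))
           - t / real (Suc n) * ((- t) ^ Suc k * beta_coeff (Suc n) k)) sums
          (- t * (harm_series n t - harm_series (Suc n) t)
           - t / real (Suc n) * log_series (Suc n) t)"
    by (intro sums_mult sums_diff harm_series_sums log_series_sums assms)
  also have "(\<lambda>k. - t * (?f k - (- t) ^ Suc k * (harm k * beta_coeff (Suc n) k))
           - t / real (Suc n) * ((- t) ^ Suc k * beta_coeff (Suc n) k)) = (\<lambda>k. ?f (Suc k))"
  proof
    fix k
    have 1: "beta_coeff n (Suc k) / real (Suc k) = beta_coeff (Suc n) k / real (Suc n)"
      by (simp add: beta_coeff_shift del: of_nat_Suc)
    have 2: "beta_coeff n (Suc k) = beta_coeff n k - beta_coeff (Suc n) k"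
      using beta_coeff_pascal[of n k] by simp
    have "?f (Suc k) = - t * (- t) ^ Suc k * (harm k * beta_coeff n (Suc k)
        + beta_coeff n (Suc k) / real (Suc k))"
      by (simp add: harm_Suc inverse_eq_divide algebra_simps del: of_nat_Suc)
    also have "\<dots> = - t * (- t) ^ Suc k * (harm k * (beta_coeff n k - beta_coeff (Suc n) k)
        + beta_coeff (Suc n) k / real (Suc n))"
      unfolding 1 unfolding 2 ..
    finally show "- t * (?f k - (- t) ^ Suc k * (harm k * beta_coeff (Suc n) k))
           - t / real (Suc n) * ((- t) ^ Suc k * beta_coeff (Suc n) k) = ?f (Suc k)"
      by (simp add: algebra_simps del: of_nat_Suc)
  qed
  finally have 1: "(\<lambda>k. ?f (Suc k)) sums (- t * (harm_series n t - harm_series (Suc n) t)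
           - t / real (Suc n) * log_series (Suc n) t)" .
  have 2: "(\<lambda>k. ?f (Suc k)) sums harm_series n t"
    using harm_series_sums[OF assms, of n] by (subst sums_Suc_iff) (simp add: harm_expand)
  show ?thesis using sums_unique2[OF 1 2] by (simp add: algebra_simps)
qed

text \<open>
  Termwise: \<open>beta_coeff (Suc n) k - beta_coeff n k = - beta_coeff n (Suc k)\<close>, and by
  \<open>beta_coeff_shift\<close> this cancels the denominator \<open>k + 1\<close>.
\<close>

lemma harm_dilog_series_Suc:
  assumes "\<bar>t\<bar> < 1"
  shows "harm_dilog_series (Suc n) t = harm_dilog_series n t - harm_series (Suc n) t / real (Suc n)"
proof -
  have "(\<lambda>k. (- t) ^ Suc k * (harm k * beta_coeff n k / real (Suc k))
           - (- t) ^ Suc k * (harm k * beta_coeff (Suc n) k) / real (Suc n)) sums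
        (harm_dilog_series n t - harm_series (Suc n) t / real (Suc n))"
    by (intro sums_diff sums_divide harm_series_sums harm_dilog_series_sums assms)
  also have "(\<lambda>k. (- t) ^ Suc k * (harm k * beta_coeff n k / real (Suc k))
           - (- t) ^ Suc k * (harm k * beta_coeff (Suc n) k) / real (Suc n)) =
        (\<lambda>k. (- t) ^ Suc k * (harm k * beta_coeff (Suc n) k / real (Suc k)))"
  proof
    fix k
    have "beta_coeff n k / real (Suc k) - beta_coeff (Suc n) k / real (Suc n)
        = beta_coeff (Suc n) k / real (Suc k)"
      unfolding beta_coeff_pascal[symmetric, of n k] beta_coeff_shift
      by (simp add: add_divide_distrib del: of_nat_Suc)
    then show "(- t) ^ Suc k * (harm k * beta_coeff n k / real (Suc k))
           - (- t) ^ Suc k * (harm k * beta_coeff (Suc n) k) / real (Suc n) =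
        (- t) ^ Suc k * (harm k * beta_coeff (Suc n) k / real (Suc k))"
      by (metis (no_types, opaque_lifting) mult.assoc right_diff_distrib times_divide_eq_right)
  qed
  finally show ?thesis
    using harm_dilog_series_sums[OF assms, of "Suc n"] sums_unique2 by blast
qed

section \<open>The initial values\<close>

lemma log_series_0:
  assumes "\<bar>t\<bar> < 1"
  shows "log_series 0 t = - ln (1 + t)"
proof -
  have "ln (1 + t) = (\<Sum>k. (- 1) ^ k * (1 / real (k + 1)) * (1 + t - 1) ^ Suc k)"
    by (rule ln_series) (use assms in auto)
  also have "\<dots> = (\<Sum>k. - ((- t) ^ Suc k * beta_coeff 0 k))"
    by (intro suminf_cong) (simp add: power_minus[of t] beta_coeff_0)
  also have "\<dots> = - log_series 0 t"
    unfolding log_series_def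
    using log_series_sums[OF assms, of 0] by (intro suminf_minus) (rule sums_summable)
  finally show ?thesis by simp
qed

text \<open>
  Multiplying the series by \<open>1 + x\<close> replaces \<open>harm\<close> by its differences \<open>1 / (k + 1)\<close>, leaving the
  logarithmic series.
\<close>

lemma harm_generating_function:
  fixes x :: real
  assumes "\<bar>x\<bar> < 1"
  shows "(\<lambda>k. (- 1) ^ Suc k * harm k * x ^ k) sums (ln (1 + x) / (1 + x))"
proof -
  define a where "a k = (- 1) ^ Suc k * harm k * x ^ k" for k
  have "summable (\<lambda>k. real k * \<bar>x\<bar> ^ k)"
    using summable_norm_cancel sums_summable[OF geometric_deriv_sums[of "\<bar>x\<bar>"]] assms
    by (subst summable_powser_split_head[symmetric]) simp
  then have sm: "summable a"
  proof (rule summable_comparison_test')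
    fix k show "norm (a k) \<le> real k * \<bar>x\<bar> ^ k"
      using mult_right_mono[OF harm_le[of k], of "\<bar>x\<bar> ^ k"]
      by (simp add: a_def abs_mult power_abs harm_nonneg)
  qed
  then obtain A where A: "a sums A" by (auto simp: summable_def)
  have "(\<lambda>k. a (Suc k)) sums A" using A by (subst sums_Suc_iff) (simp add: a_def harm_def)
  then have "(\<lambda>k. a (Suc k) + x * a k) sums (A + x * A)" by (intro sums_add sums_mult A)
  also have "(\<lambda>k. a (Suc k) + x * a k) = (\<lambda>k. - ((- x) ^ Suc k * beta_coeff 0 k))"
    by (simp add: fun_eq_iff a_def harm_Suc beta_coeff_0 power_minus[of x] algebra_simps
        inverse_eq_divide)
  finally have "A + x * A = ln (1 + x)"
    using sums_minus[OF log_series_sums[OF assms, of 0]] log_series_0[OF assms] sums_unique2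
    by fastforce
  moreover have "1 + x \<noteq> 0" using assms by auto
  ultimately have "A = ln (1 + x) / (1 + x)" by (simp add: field_simps)
  with A show ?thesis by (simp add: a_def[abs_def])
qed

lemma harm_series_0:
  assumes "0 < t" "t < 1"
  shows "harm_series 0 t = (ln (1 + t))\<^sup>2 / 2"
proof -
  define a :: "nat \<Rightarrow> real" where "a k = (- 1) ^ Suc k * harm k" for k
  have sm: "summable (\<lambda>k. a k * x ^ k)" if "\<bar>x\<bar> < 1" for x
    using sums_summable[OF harm_generating_function[OF that]] by (simp add: a_def)
  have val: "(\<Sum>k. a k * x ^ k) = ln (1 + x) / (1 + x)" if "\<bar>x\<bar> < 1" for x
    using sums_unique[OF harm_generating_function[OF that]] by (simp add: a_def)
  have eq: "harm_series 0 = (\<lambda>x. \<Sum>k. x ^ Suc k * (a k / real (Suc k)))"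
  proof
    fix x :: real
    show "harm_series 0 x = (\<Sum>k. x ^ Suc k * (a k / real (Suc k)))"
      unfolding harm_series_def
      by (intro suminf_cong) (simp add: a_def beta_coeff_0 power_minus[of x])
  qed
  have d: "(harm_series 0 has_field_derivative ln (1 + x) / (1 + x)) (at x)" if "\<bar>x\<bar> < 1" for x
    using has_field_derivative_antiderivative_series[OF sm that] that by (simp add: eq val)
  define f where "f x = harm_series 0 x - (ln (1 + x))\<^sup>2 / 2" for x
  have "f t = f 0"
  proof (rule DERIV_isconst3[where a = "-1" and b = 1 and f = f])
    fix x :: real assume "x \<in> {-1<..<1}"
    then show "(f has_real_derivative 0) (at x)"
      unfolding f_def by (auto intro!: derivative_eq_intros d simp: field_simps)
  qed (use assms in auto)
  then show ?thesis by (simp add: f_def harm_series_def)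
qed

definition trilog_closed_form :: "real \<Rightarrow> real" where
  "trilog_closed_form t = 1 / 2 * ln t * (ln (t + 1)) ^ 2 - 1 / 3 * (ln (1 + t)) ^ 3
     - ln (1 + t) * polylog 2 (1 / (1 + t)) - polylog 3 (1 / (1 + t)) + zeta 3"

text \<open>
  All terms containing \<open>1 / (1 + t)\<close> cancel: the derivative of \<open>polylog 3\<close> against that of the
  factor \<open>ln (1 + t)\<close> of \<open>polylog 2\<close>, and the derivative of \<open>polylog 2\<close>, which is elementary,
  against the pure logarithms.
\<close>

lemma has_field_derivative_trilog_closed_form:
  assumes "0 < t"
  shows "(trilog_closed_form has_field_derivative (ln (1 + t))\<^sup>2 / (2 * t)) (at t)"
proof -
  let ?x = "1 / (1 + t)"
  have x: "0 < ?x" "?x < 1" using assms by auto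
  have dx: "((\<lambda>t. 1 / (1 + t)) has_field_derivative - (?x\<^sup>2)) (at t)"
    using assms by (auto intro!: derivative_eq_intros simp: power2_eq_square)
  have l: "ln (1 - ?x) = ln t - ln (1 + t)"
  proof -
    have "1 - ?x = t / (1 + t)" using assms by (simp add: field_simps)
    then show ?thesis using assms by (simp add: ln_div)
  qed
  have cancel: "- a / y * - (y\<^sup>2) = a * y" for a y :: real
    by (simp add: power2_eq_square)
  have d2: "((\<lambda>t. polylog 2 (1 / (1 + t))) has_field_derivative (ln t - ln (1 + t)) * ?x) (at t)"
    using DERIV_chain2[OF has_field_derivative_dilog[OF x] dx]
    unfolding cancel l .
  have d3: "((\<lambda>t. polylog 3 (1 / (1 + t))) has_field_derivative - polylog 2 ?x * ?x) (at t)"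
    using DERIV_chain2[OF has_field_derivative_polylog_Suc[OF x, of 2] dx]
    using x(1) by (simp add: power2_eq_square numeral_3_eq_3 numeral_2_eq_2 split: if_splits)
  have dl: "((\<lambda>t. ln (1 + t)) has_field_derivative ?x) (at t)"
    using assms by (auto intro!: derivative_eq_intros)
  have dl2: "((\<lambda>t. (ln (1 + t))\<^sup>2) has_field_derivative 2 * ln (1 + t) * ?x) (at t)"
    using assms by (auto intro!: derivative_eq_intros dl)
  have e1: "((\<lambda>t. 1 / 2 * ln t * (ln (1 + t))\<^sup>2) has_field_derivative
      1 / 2 * (1 / t) * (ln (1 + t))\<^sup>2 + 2 * ln (1 + t) * ?x * (1 / 2 * ln t)) (at t)"
    by (intro DERIV_mult DERIV_cmult DERIV_ln_divide dl2 assms)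
  have e2: "((\<lambda>t. 1 / 3 * (ln (1 + t)) ^ 3) has_field_derivative
      1 / 3 * (3 * (ln (1 + t))\<^sup>2 * ?x)) (at t)"
    using DERIV_power[OF dl, of 3] by (intro DERIV_cmult) simp
  have "(trilog_closed_form has_field_derivative
      1 / 2 * (1 / t) * (ln (1 + t))\<^sup>2 + 2 * ln (1 + t) * ?x * (1 / 2 * ln t)
      - 1 / 3 * (3 * (ln (1 + t))\<^sup>2 * ?x)
      - (?x * polylog 2 ?x + (ln t - ln (1 + t)) * ?x * ln (1 + t))
      - - polylog 2 ?x * ?x + 0) (at t)"
    unfolding trilog_closed_form_def add.commute[of _ "1::real"]
    by (rule DERIV_add[OF DERIV_diff[OF DERIV_diff[OF DERIV_diff[OF e1 e2]
          DERIV_mult[OF dl d2]] d3] DERIV_const])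
  moreover have "1 / 2 * (1 / t) * L\<^sup>2 + 2 * L * y * (1 / 2 * ln t)
      - 1 / 3 * (3 * L\<^sup>2 * y) - (y * P + (ln t - L) * y * L)
      - - P * y + 0 = L\<^sup>2 / (2 * t)" for L y P :: real
    by (simp add: algebra_simps power2_eq_square)
  ultimately show ?thesis by (simp only:)
qed

lemma trilog_closed_form_tendsto_0: "(trilog_closed_form \<longlongrightarrow> 0) (at_right 0)"
proof -
  have "((\<lambda>t::real. ln t * (ln (t + 1)) ^ 2) \<longlongrightarrow> 0) (at_right 0)"
    by real_asymp
  moreover have "((\<lambda>t. polylog m (1 / (1 + t))) \<longlongrightarrow> polylog m 1) (at_right 0)" if "m \<ge> 2" for m
  proof -
    have "continuous_on {0..1} (\<lambda>t. polylog m (1 / (1 + t)))"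
      by (rule continuous_on_compose2[OF continuous_on_polylog[OF that]])
        (auto intro!: continuous_intros)
    from continuous_on_Icc_at_rightD[OF this] show ?thesis by simp
  qed
  moreover have "((\<lambda>t::real. ln (1 + t)) \<longlongrightarrow> 0) (at_right 0)"
    by (auto intro!: tendsto_eq_intros)
  ultimately have "(trilog_closed_form \<longlongrightarrow>
      1 / 2 * 0 - 1 / 3 * 0 ^ 3 - 0 * polylog 2 1 - polylog 3 1 + zeta 3) (at_right 0)"
    unfolding trilog_closed_form_def mult.assoc[of "1 / 2"] by (intro tendsto_intros) simp_all
  then show ?thesis by (simp add: polylog_3_1)
qed

text \<open>
  Both sides are antiderivatives of \<open>harm_series 0 t / t\<close> on \<open>(0, 1)\<close> with right limit \<open>0\<close> at \<open>0\<close>.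
\<close>

lemma harm_dilog_series_0:
  assumes "0 < t" "t < 1"
  shows "harm_dilog_series 0 t = trilog_closed_form t"
proof -
  define a :: "nat \<Rightarrow> real" where "a k = (- 1) ^ Suc k * (harm k * beta_coeff 0 k)" for k
  have sm: "summable (\<lambda>k. a k * x ^ k)" if "\<bar>x\<bar> < 1" for x
    using harm_beta_coeff_bound[of _ 0] that
    by (intro summable_bounded_mult_power) (auto simp: a_def abs_mult)
  have eq: "(- x) ^ Suc k * (harm k * beta_coeff 0 k) = x ^ Suc k * a k" for x :: real and k
    by (simp add: a_def power_minus[of x])
  have d: "(harm_dilog_series 0 has_field_derivative (\<Sum>k. a k * x ^ k)) (at x)"
    if "\<bar>x\<bar> < 1" for x
  proof -
    have "harm_dilog_series 0 = (\<lambda>x. \<Sum>k. x ^ Suc k * (a k / real (Suc k)))"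
      unfolding harm_dilog_series_def times_divide_eq_right eq ..
    then show ?thesis
      using has_field_derivative_antiderivative_series[OF sm that] by simp
  qed
  have val: "(\<Sum>k. a k * x ^ k) = (ln (1 + x))\<^sup>2 / (2 * x)" if "0 < x" "x < 1" for x
  proof -
    have "x * (\<Sum>k. a k * x ^ k) = harm_series 0 x"
      unfolding harm_series_def eq using suminf_mult[OF sm[of x], of x] that
      by (simp add: mult_ac)
    then show ?thesis using harm_series_0[OF that] that by (simp add: field_simps)
  qed
  have "harm_dilog_series 0 \<midarrow>0\<rightarrow> harm_dilog_series 0 0"
    using DERIV_isCont[OF d[of 0]] by (simp add: isCont_def)
  then have "(harm_dilog_series 0 \<longlongrightarrow> 0) (at_right 0)"
    by (simp add: harm_dilog_series_def filterlim_at_split)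
  then have "((\<lambda>t. harm_dilog_series 0 t - trilog_closed_form t) \<longlongrightarrow> 0 - 0) (at_right 0)"
    by (intro tendsto_diff trilog_closed_form_tendsto_0)
  moreover have "((\<lambda>t. harm_dilog_series 0 t - trilog_closed_form t) has_real_derivative 0) (at x)"
    if "0 < x" "x < 1" for x
    using DERIV_diff[OF d has_field_derivative_trilog_closed_form, of x] that val by simp
  ultimately have "harm_dilog_series 0 t - trilog_closed_form t = 0"
    by (intro has_real_derivative_zero_imp_right_limit[of 0 1]) (use assms in auto)
  then show ?thesis by simp
qed

section \<open>Solving the recurrences\<close>

lemma divide_recurrence:
  fixes t :: real
  assumes "t * x = (t + 1) * y + t / a * b" and "t \<noteq> 0"
  shows "x = (t + 1) / t * y + b / a"
proof -
  have "t * x = t * ((t + 1) / t * y + b / a)"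
    using assms by (simp add: distrib_left)
  then show ?thesis using assms(2) by simp
qed

lemma log_series_closed:
  assumes "0 < t" "t < 1"
  defines "w \<equiv> (t + 1) / t"
  shows "log_series n t = (\<Sum>p<n. w ^ p / real (n - p)) - w ^ n * ln (1 + t)"
proof (induction n)
  case 0
  show ?case using log_series_0[of t] assms(1,2) by simp
next
  case (Suc n)
  have "log_series (Suc n) t = w * log_series n t + 1 / real (Suc n)"
    unfolding w_def by (rule divide_recurrence) (use log_series_Suc[of t n] assms in auto)
  also have "\<dots> = (1 / real (Suc n) + (\<Sum>p<n. w ^ Suc p / real (n - p))) - w ^ Suc n * ln (1 + t)"
    by (simp add: Suc.IH algebra_simps sum_distrib_left)
  also have "1 / real (Suc n) + (\<Sum>p<n. w ^ Suc p / real (n - p))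
      = (\<Sum>p<Suc n. w ^ p / real (Suc n - p))"
    by (subst sum.lessThan_Suc_shift) simp
  finally show ?case .
qed

text \<open>
  In \<open>T (n + 1) = w T n + A (n + 1) / (n + 1)\<close>, the coefficient \<open>c n p\<close> of \<open>w ^ p\<close> moves to
  position \<open>p + 1\<close>, with \<open>n - p\<close> unchanged, and receives \<open>1 / (n - p) / (n + 1)\<close> from \<open>A\<close>:
  exactly the step from \<open>harm n\<close> to \<open>harm (n + 1)\<close>.
\<close>

lemma harm_series_closed:
  assumes "0 < t" "t < 1"
  defines "w \<equiv> (t + 1) / t"
  shows "harm_series n t = w ^ n * (ln (1 + t))\<^sup>2 / 2 - harm n * w ^ n * ln (1 + t)
    + (\<Sum>p<n. (harm n - harm (n - p) + 1 / real (n - p)) / real (n - p) * w ^ p)"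
proof (induction n)
  case 0
  show ?case using harm_series_0[OF assms(1,2)] by (simp add: harm_expand)
next
  case (Suc n)
  define L where "L = ln (1 + t)"
  define N where "N = real (Suc n)"
  define c :: "nat \<Rightarrow> nat \<Rightarrow> real"
    where "c m p = (harm m - harm (m - p) + 1 / real (m - p)) / real (m - p)" for m p
  define S where "S = (\<Sum>p<n. c n p * w ^ p)"
  define T where "T = (\<Sum>p<Suc n. w ^ p / real (Suc n - p))"
  have harm_N: "harm (Suc n) = harm n + 1 / N"
    by (simp add: harm_Suc N_def inverse_eq_divide)
  have IH: "harm_series n t = w ^ n * L\<^sup>2 / 2 - harm n * w ^ n * L + S"
    using Suc.IH by (simp add: L_def S_def c_def)
  have "harm_series (Suc n) t = w * harm_series n t + log_series (Suc n) t / real (Suc n)"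
    unfolding w_def by (rule divide_recurrence) (use harm_series_Suc[of t n] assms in auto)
  also have "log_series (Suc n) t = T - w ^ Suc n * L"
    using log_series_closed[OF assms(1,2), of "Suc n"] by (simp only: w_def T_def L_def)
  also have "w * harm_series n t + (T - w ^ Suc n * L) / real (Suc n)
      = w ^ Suc n * L\<^sup>2 / 2 - (harm n + 1 / N) * w ^ Suc n * L + (w * S + T / N)"
    unfolding IH N_def[symmetric] by (simp add: algebra_simps diff_divide_distrib)
  also have "w * S + T / N = (\<Sum>p<Suc n. c (Suc n) p * w ^ p)"
  proof -
    have "c n p + 1 / real (n - p) / N = c (Suc n) (Suc p)" for p
      by (simp add: c_def harm_N add_divide_distrib diff_divide_distrib mult_ac)
    then have "c (Suc n) (Suc p) = c n p + 1 / real (n - p) / N" for p by metis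
    then have "c (Suc n) (Suc p) * w ^ Suc p = w * (c n p * w ^ p) + w ^ Suc p / real (n - p) / N" for p
      by (simp add: distrib_right)
    moreover have "c (Suc n) 0 = 1 / N / N" by (simp add: c_def N_def)
    ultimately show ?thesis
      unfolding S_def T_def sum.lessThan_Suc_shift
      by (simp add: sum.distrib sum_distrib_left sum_divide_distrib add_divide_distrib N_def
          del: power_Suc of_nat_Suc)
  qed
  finally show ?case by (simp only: harm_N c_def L_def)
qed

lemma sum_triangle_step:
  fixes h :: "nat \<Rightarrow> nat \<Rightarrow> real"
  shows "(\<Sum>p<Suc n. (\<Sum>k=1..Suc n - p. h p k) * w ^ p)
    = (\<Sum>p<n. (\<Sum>k=1..n - p. h p k) * w ^ p) + (\<Sum>p<Suc n. h p (Suc n - p) * w ^ p)"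
proof -
  have "(\<Sum>k=1..Suc n - p. h p k) = (\<Sum>k=1..n - p. h p k) + h p (Suc n - p)" if "p < Suc n" for p
    using that by (simp add: Suc_diff_le)
  then have "(\<Sum>p<Suc n. (\<Sum>k=1..Suc n - p. h p k) * w ^ p)
      = (\<Sum>p<Suc n. (\<Sum>k=1..n - p. h p k) * w ^ p + h p (Suc n - p) * w ^ p)"
    by (intro sum.cong) (auto simp: distrib_right)
  then show ?thesis by (simp add: sum.distrib)
qed

definition harm_dilog_closed_form :: "nat \<Rightarrow> real \<Rightarrow> real" where
  "harm_dilog_closed_form n t = trilog_closed_form t
     + ln (1 + t) * (\<Sum>k=1..n. harm k / real k * ((t + 1) / t) ^ k)
     - 1 / 2 * (ln (1 + t)) ^ 2 * (\<Sum>k=1..n. 1 / real k * ((t + 1) / t) ^ k)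
     - (\<Sum>p<n. (\<Sum>k=1..n-p. (harm (p + k) - harm k) / (real (p + k) * real k)
                                  + 1 / (real k ^ 2 * real (p + k)))
                    * ((t + 1) / t) ^ p)"

text \<open>
  In the step the new term \<open>k = n + 1 - p\<close> of each inner sum must be the coefficient of \<open>w ^ p\<close> in
  \<open>harm_series (n + 1) t / (n + 1)\<close>; this is \<open>harm_series_closed\<close> with \<open>p + k = n + 1\<close>.
\<close>

lemma harm_dilog_series_closed:
  assumes "0 < t" "t < 1"
  shows "harm_dilog_series n t = harm_dilog_closed_form n t"
proof (induction n)
  case 0
  show ?case using harm_dilog_series_0[OF assms] by (simp add: harm_dilog_closed_form_def)
next
  case (Suc n)
  define w where "w = (t + 1) / t"
  define L where "L = ln (1 + t)"
  define N where "N = real (Suc n)"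
  define h :: "nat \<Rightarrow> nat \<Rightarrow> real"
    where "h p k = (harm (p + k) - harm k) / (real (p + k) * real k)
                     + 1 / (real k ^ 2 * real (p + k))" for p k
  define c :: "nat \<Rightarrow> real"
    where "c p = (harm (Suc n) - harm (Suc n - p) + 1 / real (Suc n - p)) / real (Suc n - p)" for p
  define S where "S = (\<Sum>p<Suc n. c p * w ^ p)"
  have S: "(\<Sum>p<Suc n. h p (Suc n - p) * w ^ p) = S / N"
    unfolding S_def sum_divide_distrib
  proof (rule sum.cong[OF refl])
    fix p assume "p \<in> {..<Suc n}"
    then have "p + (Suc n - p) = Suc n" by auto
    moreover have "(a / (b * m) + 1 / (m\<^sup>2 * b)) * x = (a + 1 / m) / m * x / b" for a b m x :: real
      by (simp add: add_divide_distrib distrib_left distrib_right power2_eq_square mult_ac)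
    ultimately show "h p (Suc n - p) * w ^ p = c p * w ^ p / N"
      by (simp only: h_def c_def N_def)
  qed
  have closed: "harm_dilog_closed_form m t = trilog_closed_form t
      + L * (\<Sum>k=1..m. harm k / real k * w ^ k)
      - 1 / 2 * L\<^sup>2 * (\<Sum>k=1..m. 1 / real k * w ^ k)
      - (\<Sum>p<m. (\<Sum>k=1..m-p. h p k) * w ^ p)" for m
    by (simp only: harm_dilog_closed_form_def L_def w_def h_def)
  have "harm_series (Suc n) t = w ^ Suc n * L\<^sup>2 / 2 - harm (Suc n) * w ^ Suc n * L + S"
    using harm_series_closed[OF assms, of "Suc n"] by (simp only: S_def c_def L_def w_def)
  moreover have "harm_dilog_series (Suc n) t
      = harm_dilog_closed_form n t - harm_series (Suc n) t / N"
    using harm_dilog_series_Suc[of t n] Suc.IH assms by (simp add: N_def)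
  moreover have "harm_dilog_closed_form (Suc n) t = harm_dilog_closed_form n t
      + L * (harm (Suc n) / N * w ^ Suc n) - 1 / 2 * L\<^sup>2 * (1 / N * w ^ Suc n) - S / N"
    unfolding closed sum_triangle_step S
    by (simp add: N_def distrib_left del: of_nat_Suc power_Suc sum.lessThan_Suc)
  ultimately show ?case
    by (simp add: add_divide_distrib diff_divide_distrib mult_ac del: power_Suc)
qed

section \<open>Passage to the boundary point\<close>

text \<open>
  For \<open>n \<ge> 1\<close> the Beta value is at most \<open>1 / ((k + 1) (k + 2))\<close>, which absorbs the crude bound
  \<open>harm k \<le> k\<close>.
\<close>

lemma harm_dilog_term_bound:
  assumes "n \<ge> 1" "\<bar>t\<bar> \<le> 1"
  shows "\<bar>(- t) ^ Suc k * (harm k * beta_coeff n k / real (Suc k))\<bar> \<le> 1 / real (Suc k) ^ 2"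
proof -
  have "beta_coeff n k \<le> beta_coeff 1 k" by (rule beta_coeff_decseq) fact
  also have "beta_coeff 1 k = 1 / (real (Suc k) * real (Suc (Suc k)))"
    by (simp add: beta_coeff_def)
  finally have "harm k * beta_coeff n k \<le> real k * (1 / (real (Suc k) * real (Suc (Suc k))))"
    by (intro mult_mono harm_le beta_coeff_nonneg) auto
  also have "\<dots> \<le> 1 / real (Suc k)" by (simp add: divide_simps)
  finally have "harm k * beta_coeff n k / real (Suc k) \<le> 1 / real (Suc k) / real (Suc k)"
    by (rule divide_right_mono) simp
  moreover have "\<bar>(- t) ^ Suc k\<bar> \<le> 1"
    using assms(2) power_le_one[of "\<bar>t\<bar>" "Suc k"] by (simp only: power_abs abs_minus_cancel)
  ultimately have "\<bar>(- t) ^ Suc k\<bar> * (harm k * beta_coeff n k / real (Suc k))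
      \<le> 1 * (1 / real (Suc k) / real (Suc k))"
    by (intro mult_mono) (auto simp: harm_nonneg beta_coeff_nonneg)
  then show ?thesis
    by (simp add: abs_mult harm_nonneg beta_coeff_nonneg power2_eq_square del: power_Suc of_nat_Suc)
qed

lemma continuous_on_harm_dilog_series:
  assumes "n \<ge> 1"
  shows "continuous_on {-1..1} (harm_dilog_series n)"
  unfolding harm_dilog_series_def
proof (rule continuous_on_suminf_dominated)
  show "summable (\<lambda>k. 1 / real (Suc k) ^ 2)" by (rule summable_inverse_Suc_power) simp
qed (use harm_dilog_term_bound[OF assms] in \<open>auto intro!: continuous_intros simp del: of_nat_Suc\<close>)

lemma continuous_on_harm_dilog_closed_form:
  "continuous_on {0<..} (harm_dilog_closed_form n)"
proof -
  have "continuous_on {0<..} (\<lambda>t. polylog m (1 / (1 + t)))" if "m \<ge> 2" for m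
    by (rule continuous_on_compose2[OF continuous_on_polylog[OF that]])
      (auto intro!: continuous_intros)
  then show ?thesis
    unfolding harm_dilog_closed_form_def trilog_closed_form_def
    by (auto intro!: continuous_intros)
qed

lemma harm_dilog_series_closed_at_1:
  assumes "n \<ge> 1"
  shows "harm_dilog_series n 1 = harm_dilog_closed_form n 1"
proof -
  have "continuous_on {1/2..1} (harm_dilog_closed_form n)"
    by (rule continuous_on_subset[OF continuous_on_harm_dilog_closed_form]) auto
  then have 1: "(harm_dilog_closed_form n \<longlongrightarrow> harm_dilog_closed_form n 1) (at_left 1)"
    by (rule continuous_on_Icc_at_leftD) simp
  have "(harm_dilog_series n \<longlongrightarrow> harm_dilog_series n 1) (at_left 1)"
    by (rule continuous_on_Icc_at_leftD[OF continuous_on_harm_dilog_series[OF assms]]) simp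
  moreover have "\<forall>\<^sub>F t in at_left (1::real). harm_dilog_series n t = harm_dilog_closed_form n t"
    unfolding eventually_at_left[OF zero_less_one]
    using harm_dilog_series_closed by (intro exI[of _ 0]) auto
  ultimately have "(harm_dilog_closed_form n \<longlongrightarrow> harm_dilog_series n 1) (at_left 1)"
    by (rule Lim_transform_eventually)
  from tendsto_unique[OF _ this 1] show ?thesis by simp
qed

theorem theorem2p14:
  fixes n :: nat and t :: real
  assumes "n \<ge> 1" and "0 < t" and "t \<le> 1"
  shows "(\<lambda>k. (- t) ^ Suc k * harm (Suc k - 1)
              / (real (Suc k) ^ 2 * real ((n + Suc k) choose Suc k))) sums
    (1 / 2 * ln t * (ln (t + 1)) ^ 2 - 1 / 3 * (ln (1 + t)) ^ 3
     - ln (1 + t) * polylog 2 (1 / (1 + t)) - polylog 3 (1 / (1 + t)) + zeta 3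
     + ln (1 + t) * (\<Sum>k=1..n. harm k / real k * ((t + 1) / t) ^ k)
     - 1 / 2 * (ln (1 + t)) ^ 2 * (\<Sum>k=1..n. 1 / real k * ((t + 1) / t) ^ k)
     - (\<Sum>p=0..n-1. (\<Sum>k=1..n-p. (harm (p + k) - harm k) / (real (p + k) * real k)
                                  + 1 / (real k ^ 2 * real (p + k)))
                    * ((t + 1) / t) ^ p))"
proof -
  have "{..<n} = {0..n-1}" using assms(1) by auto
  have "summable (\<lambda>k. (- t) ^ Suc k * (harm k * beta_coeff n k / real (Suc k)))"
  proof (rule summable_comparison_test')
    show "summable (\<lambda>k. 1 / real (Suc k) ^ 2)" by (rule summable_inverse_Suc_power) simp
    fix k show "norm ((- t) ^ Suc k * (harm k * beta_coeff n k / real (Suc k)))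
        \<le> 1 / real (Suc k) ^ 2"
      using harm_dilog_term_bound[of n t k] assms by simp
  qed
  then have "(\<lambda>k. (- t) ^ Suc k * (harm k * beta_coeff n k / real (Suc k))) sums
      harm_dilog_series n t"
    unfolding harm_dilog_series_def by (rule summable_sums)
  also have "(\<lambda>k. (- t) ^ Suc k * (harm k * beta_coeff n k / real (Suc k))) =
      (\<lambda>k. (- t) ^ Suc k * harm (Suc k - 1)
              / (real (Suc k) ^ 2 * real ((n + Suc k) choose Suc k)))"
    by (simp add: fun_eq_iff beta_coeff_eq_binomial power2_eq_square mult_ac
        del: binomial_Suc_Suc of_nat_Suc power_Suc)
  also have "harm_dilog_series n t = harm_dilog_closed_form n t"
    using harm_dilog_series_closed harm_dilog_series_closed_at_1 assms by (cases "t = 1") auto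
  finally show ?thesis
    using \<open>{..<n} = {0..n-1}\<close>
    by (simp only: harm_dilog_closed_form_def trilog_closed_form_def)
qed

end
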